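(* Let $\mathcal{A}$ be a Sperner system over $\{1,\dots,n\}$, and assume that $n\ge 4$. If $\mathcal{A}$ is $1$-homogeneous or has exactly one block, then $\mathcal{A}$ is reconstructible.
   Context: A set system over a finite set $A$ (the ground set) is a set of subsets of $A$, called blocks; it is a Sperner system if no block is included in another. It is $k$-homogeneous if each of its blocks has cardinality $k$. Set systems $\mathcal A$ over $A$ and $\mathcal B$ over $B$ are isomorphic, $\mathcal A\equiv\mathcal B$, if there is a bijection $\sigma\colon A\to B$ with $\{\sigma(S):S\in\mathcal A\}=\mathcal B$. For a two-element subset $I$ of $A$, let $\theta_I$ be the equivalence relation on $A$ whose only nonsingleton class is $I$; for $S\subseteq A$ let $S_I=\{x/\theta_I:x\in S\}\subseteq A/\theta_I$; for a Sperner system $\mathcal A$ over $A$ let $\mathcal A_I=\{S_I:S\in\mathcal A\}$ and let $\mathcal A^*_I$ be the set of inclusion-minimal elements of $\mathcal A_I$, a Sperner system over $A/\theta_I$. The deck of $\mathcal A$ is the multiset of the isomorphism types of the systems $\mathcal A^*_I$, with $I$ ranging over all two-element subsets of $A$. A reconstruction of $\mathcal A$ is a Sperner system over a ground set of the same cardinality that has the same deck as $\mathcal A$; $\mathcal A$ is reconstructible if it is isomorphic to all of its reconstructions. *)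

theory Defs
  imports Main "HOL-Library.Multiset"
begin

definition sperner_system :: "'a set \<Rightarrow> 'a set set \<Rightarrow> bool" where
  "sperner_system A F \<longleftrightarrow> finite A \<and> F \<subseteq> Pow A \<and> (\<forall>S\<in>F. \<forall>T\<in>F. S \<subseteq> T \<longrightarrow> S = T)"

definition homogeneous :: "nat \<Rightarrow> 'a set set \<Rightarrow> bool" where
  "homogeneous k F \<longleftrightarrow> (\<forall>S\<in>F. card S = k)"

definition isomorphic :: "'a set \<Rightarrow> 'a set set \<Rightarrow> 'b set \<Rightarrow> 'b set set \<Rightarrow> bool" where
  "isomorphic A F B G \<longleftrightarrow> (\<exists>\<sigma>. bij_betw \<sigma> A B \<and> (\<lambda>S. \<sigma> ` S) ` F = G)"

text \<open>
  The isomorphism type of a set system is its isomorphism class among the systems whose ground set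
  consists of natural numbers. Fixing the type \<open>nat\<close> makes isomorphism types of systems over
  different types comparable; on finite ground sets nothing is lost, see \<open>iso_type_eq_iff\<close>.
\<close>
definition iso_type :: "'a set \<Rightarrow> 'a set set \<Rightarrow> (nat set \<times> nat set set) set" where
  "iso_type A F = {(C, H). isomorphic A F C H}"

definition theta :: "'a set \<Rightarrow> 'a set \<Rightarrow> ('a \<times> 'a) set" where
  "theta A I = Id_on A \<union> I \<times> I"

definition block_quotient :: "'a set \<Rightarrow> 'a set \<Rightarrow> 'a set \<Rightarrow> 'a set set" where
  "block_quotient A I S = (\<lambda>x. theta A I `` {x}) ` S"

definition minimal_blocks :: "'a set set \<Rightarrow> 'a set set" where
  "minimal_blocks F = {S \<in> F. \<not> (\<exists>T\<in>F. T \<subset> S)}"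

text \<open>The inclusion-minimal blocks of the image of \<open>F\<close>; the ground set is the quotient \<open>A // theta A I\<close>.\<close>
definition contraction :: "'a set \<Rightarrow> 'a set set \<Rightarrow> 'a set \<Rightarrow> 'a set set set" where
  "contraction A F I = minimal_blocks (block_quotient A I ` F)"

definition deck :: "'a set \<Rightarrow> 'a set set \<Rightarrow> (nat set \<times> nat set set) set multiset" where
  "deck A F = image_mset (\<lambda>I. iso_type (A // theta A I) (contraction A F I))
     (mset_set {I. I \<subseteq> A \<and> card I = 2})"

definition reconstruction :: "'b set \<Rightarrow> 'b set set \<Rightarrow> 'a set \<Rightarrow> 'a set set \<Rightarrow> bool" where
  "reconstruction B G A F \<longleftrightarrow> sperner_system B G \<and> card B = card A \<and> deck B G = deck A F"

text \<open>
  A definition cannot quantify over types, so the type of the points of the reconstructions is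
  a parameter. A theorem with this type left as a type variable covers reconstructions over
  arbitrary ground sets.
\<close>
definition reconstructible :: "'b itself \<Rightarrow> 'a set \<Rightarrow> 'a set set \<Rightarrow> bool" where
  "reconstructible (_ :: 'b itself) A F \<longleftrightarrow>
     (\<forall>(B :: 'b set) G. reconstruction B G A F \<longrightarrow> isomorphic A F B G)"

lemma isomorphic_sym:
  assumes "F \<subseteq> Pow A" "isomorphic A F B G"
  shows "isomorphic B G A F"
proof -
  obtain f where f: "bij_betw f A B" "(\<lambda>S. f ` S) ` F = G"
    using assms(2) by (auto simp: isomorphic_def)
  have "inv_into A f ` f ` S = S" if "S \<in> F" for S
    using that assms(1) f(1) by (intro inv_into_image_cancel) (auto simp: bij_betw_def)
  then have "(\<lambda>S. inv_into A f ` S) ` G = F"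
    unfolding f(2)[symmetric] image_image by simp
  then show ?thesis
    using bij_betw_inv_into[OF f(1)] by (auto simp: isomorphic_def)
qed

lemma isomorphic_trans:
  assumes "isomorphic A F B G" "isomorphic B G C H"
  shows "isomorphic A F C H"
proof -
  obtain f g where f: "bij_betw f A B" "(\<lambda>S. f ` S) ` F = G"
    and g: "bij_betw g B C" "(\<lambda>S. g ` S) ` G = H"
    using assms by (auto simp: isomorphic_def)
  have "(\<lambda>S. (g \<circ> f) ` S) ` F = H"
    unfolding g(2)[symmetric] f(2)[symmetric] image_image by (simp add: image_comp)
  then show ?thesis
    using bij_betw_trans[OF f(1) g(1)] unfolding isomorphic_def by blast
qed

lemma iso_type_eq_iff:
  assumes "finite A" "F \<subseteq> Pow A" "G \<subseteq> Pow B"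
  shows "iso_type A F = iso_type B G \<longleftrightarrow> isomorphic A F B G"
proof
  assume eq: "iso_type A F = iso_type B G"
  obtain h where "bij_betw h A {0..<card A}"
    using ex_bij_betw_finite_nat[OF assms(1)] by blast
  then have AF: "isomorphic A F {0..<card A} ((\<lambda>S. h ` S) ` F)"
    by (auto simp: isomorphic_def)
  then have "isomorphic B G {0..<card A} ((\<lambda>S. h ` S) ` F)"
    using eq by (auto simp: iso_type_def)
  then show "isomorphic A F B G"
    using AF isomorphic_sym[OF assms(3)] isomorphic_trans by blast
next
  assume AB: "isomorphic A F B G"
  then have BA: "isomorphic B G A F"
    by (rule isomorphic_sym[OF assms(2)])
  have "isomorphic A F C H \<longleftrightarrow> isomorphic B G C H" for C :: "nat set" and H
    using isomorphic_trans[OF AB] isomorphic_trans[OF BA] by blast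
  then show "iso_type A F = iso_type B G"
    by (simp add: iso_type_def)
qed

end

theory Submission
  imports Defs
begin

text \<open>
  The inclusion \<open>T\<^sub>I \<subseteq> S\<^sub>I\<close> fails to imply \<open>T \<subseteq> S\<close> only if \<open>T - S\<close> is contained in \<open>I\<close> and the
  rest of \<open>I\<close> meets \<open>S\<close>. In particular, a block of a Sperner system that contains \<open>I\<close> or is disjoint
  from \<open>I\<close> stays minimal, and contracting inside a block with more than two points, or outside a
  block with two points (this uses \<open>n \<ge> 4\<close>), shows that a system all of whose contractions are
  1-homogeneous is 1-homogeneous. If all contractions have a single block, the blocks that become
  least for two disjoint pairs and for a third pair meeting both contradict each other, unless there
  is only one block. Both kinds of systems are determined by a set \<open>M\<close> of points, up to isomorphism by
  its cardinality, which can be read off from the values \<open>|M\<^sub>I| = |M| - [I \<subseteq> M]\<close>.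
\<close>

section \<open>Images of blocks under the identification of two points\<close>

lemma theta_class_eq_iff:
  assumes "I \<subseteq> A" "x \<in> A" "y \<in> A"
  shows "theta A I `` {x} = theta A I `` {y} \<longleftrightarrow> x = y \<or> x \<in> I \<and> y \<in> I"
  using assms by (auto simp: theta_def Image_def set_eq_iff)

text \<open>The class of a point t of T belongs to the image of S iff t lies in S, or t lies in I
  and I meets S. This reduces all comparisons in the quotient to comparisons in A.\<close>

lemma block_quotient_subset_iff:
  assumes "I \<subseteq> A" "S \<subseteq> A" "T \<subseteq> A"
  shows "block_quotient A I T \<subseteq> block_quotient A I S \<longleftrightarrow> T - S \<subseteq> I \<and> (T \<subseteq> S \<or> I \<inter> S \<noteq> {})"
proof -
  have "block_quotient A I T \<subseteq> block_quotient A I S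
      \<longleftrightarrow> (\<forall>t\<in>T. \<exists>s\<in>S. theta A I `` {t} = theta A I `` {s})"
    unfolding block_quotient_def by blast
  also have "\<dots> \<longleftrightarrow> (\<forall>t\<in>T. \<exists>s\<in>S. t = s \<or> t \<in> I \<and> s \<in> I)"
    using assms by (intro ball_cong bex_cong refl theta_class_eq_iff) auto
  also have "\<dots> \<longleftrightarrow> T - S \<subseteq> I \<and> (T \<subseteq> S \<or> I \<inter> S \<noteq> {})"
    by blast
  finally show ?thesis .
qed

text \<open>The quotient map is injective on every set that does not contain both points of I; if M
  contains both, dropping one of them leaves the image unchanged.\<close>

lemma card_block_quotient:
  assumes "I \<subseteq> A" "card I = 2" "M \<subseteq> A"
  shows "card (block_quotient A I M) = (if I \<subseteq> M then card M - 1 else card M)"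
proof -
  obtain a b where ab: "I = {a, b}" "a \<noteq> b"
    using assms(2) by (auto simp: card_2_iff)
  have card_eq: "card (block_quotient A I N) = card N" if "N \<subseteq> A" "\<not> I \<subseteq> N" for N
  proof -
    have "inj_on (\<lambda>x. theta A I `` {x}) N"
    proof (rule inj_onI)
      fix x y assume "x \<in> N" "y \<in> N" "theta A I `` {x} = theta A I `` {y}"
      then have "x = y \<or> {x, y} \<subseteq> I"
        using theta_class_eq_iff[OF assms(1), of x y] that(1) by blast
      then show "x = y"
        using that(2) ab \<open>x \<in> N\<close> \<open>y \<in> N\<close> by blast
    qed
    then show ?thesis
      unfolding block_quotient_def by (rule card_image)
  qed
  have "block_quotient A I M = block_quotient A I (M - {b})" if "I \<subseteq> M"
  proof (rule equalityI)
    have "M - {b} \<subseteq> A" "a \<in> M - {b}"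
      using that assms(3) ab by auto
    then show "block_quotient A I M \<subseteq> block_quotient A I (M - {b})"
      using block_quotient_subset_iff[OF assms(1) _ assms(3), of "M - {b}"] ab(1) by blast
  qed (auto simp: block_quotient_def)
  moreover have "card (block_quotient A I (M - {b})) = card M - 1" if "I \<subseteq> M"
  proof -
    have "M - {b} \<subseteq> A" "\<not> I \<subseteq> M - {b}" "b \<in> M"
      using that assms(3) ab(1) by blast+
    then show ?thesis
      using card_eq[of "M - {b}"] by (simp add: card_Diff_singleton)
  qed
  ultimately show ?thesis
    using card_eq[OF assms(3)] by simp
qed

section \<open>Minimal blocks of a contraction\<close>

lemma sperner_system_finite: "sperner_system A F \<Longrightarrow> finite F"
  unfolding sperner_system_def by (metis finite_Pow_iff finite_subset)

lemma contraction_below: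
  assumes "finite F" "S \<in> F"
  obtains T where "T \<in> F" "block_quotient A I T \<in> contraction A F I"
    "block_quotient A I T \<subseteq> block_quotient A I S"
proof -
  have "\<exists>m \<in> block_quotient A I ` F. m \<subseteq> block_quotient A I S
      \<and> (\<forall>b \<in> block_quotient A I ` F. b \<subseteq> m \<longrightarrow> m = b)"
    using assms by (intro finite_has_minimal2) auto
  then obtain m where m: "m \<in> block_quotient A I ` F" "m \<subseteq> block_quotient A I S"
    "\<forall>b \<in> block_quotient A I ` F. b \<subseteq> m \<longrightarrow> m = b"
    by (elim bexE conjE)
  then have "m \<in> contraction A F I"
    unfolding contraction_def minimal_blocks_def by auto
  then show thesis
    using that m(1,2) by blast
qed

lemma contraction_subset_Pow:
  assumes "F \<subseteq> Pow A"
  shows "contraction A F I \<subseteq> Pow (A // theta A I)"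
  using assms by (auto simp: contraction_def minimal_blocks_def block_quotient_def quotient_def)

text \<open>If I lies inside S or outside S, an inclusion T_I \<subseteq> S_I already forces T
  \<subseteq> S, hence T = S by the Sperner property. So the minimal block below S_I is S_I
  itself.\<close>

lemma block_quotient_in_contraction:
  assumes "sperner_system A F" "I \<subseteq> A" "S \<in> F" "I \<subseteq> S \<or> I \<inter> S = {}"
  shows "block_quotient A I S \<in> contraction A F I"
proof -
  obtain T where T: "T \<in> F" "block_quotient A I T \<in> contraction A F I"
    "block_quotient A I T \<subseteq> block_quotient A I S"
    using contraction_below[OF sperner_system_finite[OF assms(1)] assms(3)] .
  have "S \<subseteq> A" "T \<subseteq> A"
    using T assms by (auto simp: sperner_system_def)
  then have "T \<subseteq> S"
    using T(3) assms(4) block_quotient_subset_iff[OF assms(2)] by blast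
  then have "T = S"
    using assms T(1) by (auto simp: sperner_system_def)
  then show ?thesis
    using T(2) by simp
qed

section \<open>Recognizing the two kinds of systems from their contractions\<close>

lemma homogeneous_1_if_contractions:
  assumes sp: "sperner_system A F" and "card A \<ge> 4"
    and hom: "\<And>I. I \<subseteq> A \<Longrightarrow> card I = 2 \<Longrightarrow> homogeneous 1 (contraction A F I)"
  shows "homogeneous 1 F"
  unfolding homogeneous_def
proof
  fix S assume S: "S \<in> F"
  have fin: "finite A" "S \<subseteq> A"
    using sp S by (auto simp: sperner_system_def)
  have card1: "card (block_quotient A I S) = 1"
    if "I \<subseteq> A" "card I = 2" "I \<subseteq> S \<or> I \<inter> S = {}" for I
    using block_quotient_in_contraction[OF sp that(1) S that(3)] hom[OF that(1,2)]
    by (auto simp: homogeneous_def)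
  show "card S = 1"
  proof (cases "card S \<ge> 3")
    case True
    then have "2 \<le> card S"
      by simp
    then obtain I where I: "I \<subseteq> S" "card I = 2" "finite I"
      by (rule obtain_subset_with_card_n)
    \<comment> \<open>A pair inside S costs one point, so S would have exactly two points, against
      the case assumption.\<close>
    then have "card S - 1 = 1"
      using card1[of I] card_block_quotient[of I A S] fin by auto
    then show ?thesis
      using True by simp
  next
    case False
    \<comment> \<open>Here S has at most two of the at least four points. A pair outside S keeps its
      size, so S itself has size 1.\<close>
    then have "2 \<le> card (A - S)"
      using assms(2) fin finite_subset[OF fin(2,1)] by (simp add: card_Diff_subset)
    then obtain I where I: "I \<subseteq> A - S" "card I = 2" "finite I"
      by (rule obtain_subset_with_card_n)
    then have "I \<inter> S = {}" "I \<noteq> {}"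
      by auto
    then have "\<not> I \<subseteq> S"
      by blast
    then show ?thesis
      using card1[of I] card_block_quotient[of I A S] I \<open>I \<inter> S = {}\<close> fin(2) by auto
  qed
qed

lemma card_2_other:
  assumes "card I = 2" "a \<in> I"
  shows "\<exists>b. I = {a, b} \<and> a \<noteq> b"
proof -
  obtain x y where "I = {x, y}" "x \<noteq> y"
    using assms(1) by (auto simp: card_2_iff)
  then show ?thesis
    using assms(2) by blast
qed

lemma single_block_if_contractions:
  assumes sp: "sperner_system A F" and "card A \<ge> 4"
    and single: "\<And>I. I \<subseteq> A \<Longrightarrow> card I = 2 \<Longrightarrow> card (contraction A F I) = 1"
  shows "card F = 1"
proof -
  \<comment> \<open>A unique minimal block lies below all images. So T_I \<subseteq> S_I for every
    other block S, while T is not contained in S: of the two points of I, one lies in T - S and the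
    other in S.\<close>
  have least: "\<exists>T\<in>F. \<forall>S\<in>F. S \<noteq> T \<longrightarrow> (\<exists>t. T - S = {t} \<and> t \<in> I \<and> I - {t} \<subseteq> S)"
    if I: "I \<subseteq> A" "card I = 2" for I
  proof -
    obtain m where m: "contraction A F I = {m}"
      using single[OF I] by (auto simp: card_1_singleton_iff)
    then have "m \<in> block_quotient A I ` F"
      by (auto simp: contraction_def minimal_blocks_def)
    then obtain T where T: "T \<in> F" "m = block_quotient A I T"
      by blast
    have "\<exists>t. T - S = {t} \<and> t \<in> I \<and> I - {t} \<subseteq> S" if S: "S \<in> F" "S \<noteq> T" for S
    proof -
      have "block_quotient A I T \<subseteq> block_quotient A I S"
        using contraction_below[OF sperner_system_finite[OF sp] S(1), of A I] m T(2)
        by (metis singletonD)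
      moreover have "\<not> T \<subseteq> S" "T \<subseteq> A" "S \<subseteq> A"
        using sp S T by (auto simp: sperner_system_def)
      ultimately have *: "T - S \<subseteq> I" "I \<inter> S \<noteq> {}" "T - S \<noteq> {}"
        using block_quotient_subset_iff[OF I(1)] by auto
      obtain x y where "I = {x, y}"
        using I(2) by (auto simp: card_2_iff)
      then show ?thesis
        using * by fastforce
    qed
    then show ?thesis
      using T(1) by blast
  qed
  have "2 \<le> card A"
    using assms(2) by simp
  then obtain I where I: "I \<subseteq> A" "card I = 2" "finite I"
    by (rule obtain_subset_with_card_n)
  have "2 \<le> card (A - I)"
    using assms(2) I by (simp add: card_Diff_subset)
  then obtain J where J: "J \<subseteq> A - I" "card J = 2" "finite J"
    by (rule obtain_subset_with_card_n)
  from least[OF I(1,2)] obtain T where T: "T \<in> F"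
    "\<forall>S\<in>F. S \<noteq> T \<longrightarrow> (\<exists>t. T - S = {t} \<and> t \<in> I \<and> I - {t} \<subseteq> S)"
    by (rule bexE)
  have "J \<subseteq> A"
    using J(1) by blast
  from least[OF this J(2)] obtain U where U: "U \<in> F"
    "\<forall>S\<in>F. S \<noteq> U \<longrightarrow> (\<exists>t. U - S = {t} \<and> t \<in> J \<and> J - {t} \<subseteq> S)"
    by (rule bexE)
  have "T = U"
  proof (rule ccontr)
    assume "T \<noteq> U"
    obtain a where a: "T - U = {a}" "a \<in> I" "I - {a} \<subseteq> U"
      using T(2) U(1) \<open>T \<noteq> U\<close> by metis
    obtain c where c: "U - T = {c}" "c \<in> J" "J - {c} \<subseteq> T"
      using U(2) T(1) \<open>T \<noteq> U\<close> by metis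
    obtain b where b: "I = {a, b}" "a \<noteq> b"
      using card_2_other[OF I(2) a(2)] by blast
    obtain d where d: "J = {c, d}" "c \<noteq> d"
      using card_2_other[OF J(2) c(2)] by blast
    \<comment> \<open>The point b lies in U, and the only point of U outside T is c, which lies in J
      and so differs from b; hence b is in T. The argument for d is symmetric.\<close>
    have bd: "b \<noteq> d" "{b, d} \<subseteq> T \<inter> U"
      using a c b d J(1) by blast+
    have "{b, d} \<subseteq> A"
      using I(1) J(1) b(1) d(1) by blast
    moreover have "card {b, d} = 2"
      using bd(1) by simp
    ultimately obtain V where V: "V \<in> F"
      "\<forall>S\<in>F. S \<noteq> V \<longrightarrow> (\<exists>t. V - S = {t} \<and> t \<in> {b, d} \<and> {b, d} - {t} \<subseteq> S)"
      by (rule least[THEN bexE])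
    \<comment> \<open>A block other than V misses a point of {b, d}. Hence at most one block
      contains this pair, whereas T and U both do.\<close>
    have "V = S" if "S \<in> F" "{b, d} \<subseteq> S" for S
    proof (rule ccontr)
      assume "V \<noteq> S"
      then have "S \<noteq> V"
        by simp
      from V(2)[rule_format, OF that(1) this]
      obtain t where "V - S = {t} \<and> t \<in> {b, d} \<and> {b, d} - {t} \<subseteq> S" ..
      then show False
        using that(2) by blast
    qed
    then show False
      using T(1) U(1) bd(2) \<open>T \<noteq> U\<close> by blast
  qed
  \<comment> \<open>With the same least block for I and J, the point of T missing from another block
    would lie in both of these disjoint pairs.\<close>
  have "S = T" if "S \<in> F" for S
  proof (rule ccontr)
    assume "S \<noteq> T"
    from T(2)[rule_format, OF that this]
    obtain t where t: "T - S = {t} \<and> t \<in> I \<and> I - {t} \<subseteq> S" ..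
    from U(2)[folded \<open>T = U\<close>, rule_format, OF that \<open>S \<noteq> T\<close>]
    obtain u where u: "T - S = {u} \<and> u \<in> J \<and> J - {u} \<subseteq> S" ..
    from t u have "t = u"
      by auto
    then show False
      using t u J(1) by blast
  qed
  then have "F = {T}"
    using T(1) by blast
  then show ?thesis
    by simp
qed

section \<open>Isomorphism invariants and the transfer through the deck\<close>

lemma isomorphic_homogeneous:
  assumes "isomorphic A F B G" "F \<subseteq> Pow A"
  shows "homogeneous k F \<longleftrightarrow> homogeneous k G"
proof -
  obtain \<sigma> where \<sigma>: "bij_betw \<sigma> A B" "(\<lambda>S. \<sigma> ` S) ` F = G"
    using assms(1) by (auto simp: isomorphic_def)
  have "card (\<sigma> ` S) = card S" if "S \<in> F" for S
    using that assms(2) \<sigma>(1) by (intro card_image) (auto simp: bij_betw_def intro: inj_on_subset)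
  then show ?thesis
    unfolding homogeneous_def \<sigma>(2)[symmetric] by simp
qed

lemma isomorphic_card:
  assumes "isomorphic A F B G" "F \<subseteq> Pow A"
  shows "card F = card G"
proof -
  obtain \<sigma> where \<sigma>: "bij_betw \<sigma> A B" "(\<lambda>S. \<sigma> ` S) ` F = G"
    using assms(1) by (auto simp: isomorphic_def)
  have "inj_on (\<lambda>S. \<sigma> ` S) F"
    using inj_on_subset[OF inj_on_image_Pow assms(2)] \<sigma>(1) by (auto simp: bij_betw_def)
  then show ?thesis
    using \<sigma>(2) card_image by metis
qed

text \<open>Equal decks have the same members, and \<open>iso_type_eq_iff\<close> turns equality of
  types into isomorphism of the contractions themselves.\<close>

lemma deck_eq_imp_isomorphic:
  assumes "finite A" "F \<subseteq> Pow A" "finite B" "G \<subseteq> Pow B" "deck A F = deck B G"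
    and "I \<subseteq> A" "card I = 2"
  shows "\<exists>J\<subseteq>B. card J = 2 \<and>
    isomorphic (A // theta A I) (contraction A F I) (B // theta B J) (contraction B G J)"
proof -
  have "iso_type (A // theta A I) (contraction A F I) \<in> set_mset (deck A F)"
    using assms(1,6,7) by (simp add: deck_def)
  then have "iso_type (A // theta A I) (contraction A F I) \<in> set_mset (deck B G)"
    by (simp only: assms(5))
  then obtain J where J: "J \<subseteq> B" "card J = 2"
    "iso_type (A // theta A I) (contraction A F I) = iso_type (B // theta B J) (contraction B G J)"
    using assms(3) by (auto simp: deck_def)
  have "A // theta A I = (\<lambda>x. theta A I `` {x}) ` A"
    by (auto simp: quotient_def)
  then have "finite (A // theta A I)"
    using assms(1) by simp
  then show ?thesis
    using J iso_type_eq_iff[OF _ contraction_subset_Pow[OF assms(2)] contraction_subset_Pow[OF assms(4)]]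
    by blast
qed

section \<open>Systems described by a single set of points\<close>

lemma homogeneous_1_eq_singletons:
  assumes "homogeneous 1 F"
  shows "F = (\<lambda>x. {x}) ` \<Union>F"
proof -
  have *: "\<exists>x. S = {x}" if "S \<in> F" for S
    using assms that by (auto simp: homogeneous_def card_1_singleton_iff)
  show ?thesis
  proof (intro equalityI subsetI)
    fix S assume "S \<in> F"
    then show "S \<in> (\<lambda>x. {x}) ` \<Union>F"
      using *[of S] by auto
  next
    fix S assume "S \<in> (\<lambda>x. {x}) ` \<Union>F"
    then obtain x T where "S = {x}" "x \<in> T" "T \<in> F"
      by auto
    then show "S \<in> F"
      using *[of T] by auto
  qed
qed

text \<open>The image of a singleton is a singleton, and distinct singletons are incomparable, so
  every image is minimal. The number of blocks is therefore |M_I|.\<close>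

lemma contraction_singletons:
  "contraction A ((\<lambda>x. {x}) ` M) I = (\<lambda>c. {c}) ` block_quotient A I M"
proof -
  have "block_quotient A I ` (\<lambda>x. {x}) ` M = (\<lambda>c. {c}) ` block_quotient A I M"
    by (simp add: block_quotient_def image_image)
  then show ?thesis
    by (auto simp: contraction_def minimal_blocks_def)
qed

lemma contraction_single_block: "contraction A {K} I = {block_quotient A I K}"
  by (auto simp: contraction_def minimal_blocks_def)

lemma homogeneous_single: "homogeneous k {K} \<longleftrightarrow> card K = k"
  by (simp add: homogeneous_def)

text \<open>Suppose |M| > |N|. A pair not contained in M would give the value |M|, which exceeds
  every |N_J|; so M = A and all values are |A| - 1. A pair inside N gives |N| - 1, hence |N| = |A|,
  a contradiction. The matching hypotheses are symmetric, so that exchanging the roles yields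
  equality.\<close>

lemma card_le_if_block_quotients:
  assumes "finite A" "M \<subseteq> A" "N \<subseteq> B" "card A = card B" "card A \<ge> 3"
    and AB: "\<And>I. I \<subseteq> A \<Longrightarrow> card I = 2 \<Longrightarrow>
      \<exists>J. J \<subseteq> B \<and> card J = 2 \<and> card (block_quotient A I M) = card (block_quotient B J N)"
    and BA: "\<And>J. J \<subseteq> B \<Longrightarrow> card J = 2 \<Longrightarrow>
      \<exists>I. I \<subseteq> A \<and> card I = 2 \<and> card (block_quotient B J N) = card (block_quotient A I M)"
  shows "card M \<le> card N"
proof (rule ccontr)
  assume less: "\<not> card M \<le> card N"
  have "M = A"
  proof (rule ccontr)
    assume "M \<noteq> A"
    then obtain x where x: "x \<in> A" "x \<notin> M"
      using assms(2) by blast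
    have "1 \<le> card (A - {x})"
      using assms(5) by (simp add: card_Diff_singleton x(1))
    then have "A - {x} \<noteq> {}"
      by (metis card.empty not_one_le_zero)
    then obtain y where y: "y \<in> A" "y \<noteq> x"
      by blast
    have I: "{x, y} \<subseteq> A" "card {x, y} = 2"
      using x y by auto
    from AB[OF this] obtain J where "J \<subseteq> B" "card J = 2"
      "card (block_quotient A {x, y} M) = card (block_quotient B J N)"
      by blast
    then show False
      using less x card_block_quotient[OF I assms(2)] card_block_quotient[of J B N] assms(3)
      by (auto split: if_splits)
  qed
  have eq: "card (block_quotient A I M) = card A - 1" if "I \<subseteq> A" "card I = 2" for I
    using card_block_quotient[OF that] \<open>M = A\<close> that by auto
  \<comment> \<open>From |N| \<ge> |N_J| = |A| - 1 \<ge> 2; this provides a pair inside N and makes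
    the truncated subtraction in |N| - 1 harmless.\<close>
  have "card N \<ge> 2"
  proof -
    have "2 \<le> card A"
      using assms(5) by simp
    then obtain I where "I \<subseteq> A" "card I = 2" "finite I"
      by (rule obtain_subset_with_card_n)
    then obtain J where "J \<subseteq> B" "card J = 2" "card (block_quotient B J N) = card A - 1"
      using AB eq by metis
    then show ?thesis
      using card_block_quotient[of J B N] assms(3,5) by (auto split: if_splits)
  qed
  then obtain J where J: "J \<subseteq> N" "card J = 2" "finite J"
    by (rule obtain_subset_with_card_n)
  have "J \<subseteq> B"
    using J(1) assms(3) by blast
  from BA[OF this J(2)] obtain I where "I \<subseteq> A \<and> card I = 2 \<and>
    card (block_quotient B J N) = card (block_quotient A I M)" ..
  then have "card N - 1 = card A - 1"
    using eq[of I] card_block_quotient[OF \<open>J \<subseteq> B\<close> J(2) assms(3)] J(1) by simp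
  then show False
    using less \<open>M = A\<close> \<open>card N \<ge> 2\<close> by simp
qed

text \<open>A bijection from M to N and one between the complements are glued together.\<close>

lemma bij_betw_extending_subsets:
  assumes "finite A" "finite B" "M \<subseteq> A" "N \<subseteq> B" "card A = card B" "card M = card N"
  obtains \<sigma> where "bij_betw \<sigma> A B" "\<sigma> ` M = N"
proof -
  have fin: "finite M" "finite N"
    using assms finite_subset by auto
  obtain f where f: "bij_betw f M N"
    using finite_same_card_bij fin assms(6) by blast
  have "card (A - M) = card (B - N)"
    using assms fin by (simp add: card_Diff_subset)
  then obtain g where g: "bij_betw g (A - M) (B - N)"
    using finite_same_card_bij assms(1,2) by blast
  define \<sigma> where "\<sigma> x = (if x \<in> M then f x else g x)" for x
  have *: "bij_betw \<sigma> M N" "bij_betw \<sigma> (A - M) (B - N)"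
    using f g bij_betw_cong[of M \<sigma> f N] bij_betw_cong[of "A - M" \<sigma> g "B - N"]
    by (auto simp: \<sigma>_def)
  have "M \<union> (A - M) = A" "N \<union> (B - N) = B"
    using assms(3,4) by auto
  then have "bij_betw \<sigma> A B"
    using bij_betw_combine[OF *] by auto
  then show thesis
    using that * by (auto simp: bij_betw_def)
qed

section \<open>Reconstruction of both kinds of systems\<close>

lemma reconstructible_1_homogeneous_or_single:
  fixes A :: "'a set"
  assumes sp: "sperner_system A F" and "card A \<ge> 4" and F: "homogeneous 1 F \<or> card F = 1"
  shows "reconstructible TYPE('b) A F"
  unfolding reconstructible_def
proof (intro allI impI)
  fix B :: "'b set" and G
  assume rec: "reconstruction B G A F"
  then have spG: "sperner_system B G" and cardB: "card B = card A" and deck: "deck B G = deck A F"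
    by (auto simp: reconstruction_def)
  have fin: "finite A" "F \<subseteq> Pow A" "finite B" "G \<subseteq> Pow B"
    using sp spG by (auto simp: sperner_system_def)
  note FG = deck_eq_imp_isomorphic[OF fin(1,2,3,4) deck[symmetric]]
  note GF = deck_eq_imp_isomorphic[OF fin(3,4,1,2) deck]
  note inv = isomorphic_card[OF _ contraction_subset_Pow] isomorphic_homogeneous[OF _ contraction_subset_Pow]
  \<comment> \<open>The assumption \<open>match\<close> is kept abstract because the two cases read
    |M_I| off a contraction by different invariants.\<close>
  have card_eq: "card M = card N" if "M \<subseteq> A" "N \<subseteq> B"
    and match: "\<And>I J. I \<subseteq> A \<Longrightarrow> J \<subseteq> B \<Longrightarrow>
      isomorphic (A // theta A I) (contraction A F I) (B // theta B J) (contraction B G J) \<Longrightarrow>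
      card (block_quotient A I M) = card (block_quotient B J N)" for M N
  proof -
    have AB: "\<exists>J. J \<subseteq> B \<and> card J = 2 \<and> card (block_quotient A I M) = card (block_quotient B J N)"
      if "I \<subseteq> A" "card I = 2" for I
      using FG[OF that] match[OF that(1)] by blast
    have BA: "\<exists>I. I \<subseteq> A \<and> card I = 2 \<and> card (block_quotient B J N) = card (block_quotient A I M)"
      if J: "J \<subseteq> B" "card J = 2" for J
    proof -
      obtain I where I: "I \<subseteq> A" "card I = 2"
        "isomorphic (B // theta B J) (contraction B G J) (A // theta A I) (contraction A F I)"
        using GF[OF J] by blast
      then show ?thesis
        using match[OF I(1) J(1) isomorphic_sym[OF contraction_subset_Pow[OF fin(4)] I(3)]] by auto
    qed
    have "card A \<ge> 3" "card B \<ge> 3"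
      using assms(2) cardB by simp_all
    show ?thesis
    proof (rule antisym)
      show "card M \<le> card N"
        using card_le_if_block_quotients[OF fin(1) that(1,2) cardB[symmetric] \<open>card A \<ge> 3\<close> AB BA] .
      show "card N \<le> card M"
        using card_le_if_block_quotients[OF fin(3) that(2,1) cardB \<open>card B \<ge> 3\<close> BA AB] .
    qed
  qed
  show "isomorphic A F B G"
    using F
  proof
    assume "homogeneous 1 F"
    then obtain M where M: "F = (\<lambda>x. {x}) ` M"
      using homogeneous_1_eq_singletons by metis
    have cF: "homogeneous 1 (contraction A F I)" for I
      unfolding M contraction_singletons by (auto simp: homogeneous_def)
    have "homogeneous 1 G"
    proof (rule homogeneous_1_if_contractions[OF spG])
      fix J assume J: "J \<subseteq> B" "card J = 2"
      from GF[OF this] obtain I where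
        "isomorphic (B // theta B J) (contraction B G J) (A // theta A I) (contraction A F I)"
        by blast
      from inv(2)[OF this fin(4)] show "homogeneous 1 (contraction B G J)"
        using cF by simp
    qed (simp add: cardB assms(2))
    then obtain N where N: "G = (\<lambda>x. {x}) ` N"
      using homogeneous_1_eq_singletons by metis
    have sub: "M \<subseteq> A" "N \<subseteq> B"
      using fin M N by auto
    have "card M = card N"
    proof (intro card_eq sub)
      fix I J
      assume "isomorphic (A // theta A I) (contraction A F I) (B // theta B J) (contraction B G J)"
      \<comment> \<open>For systems of singletons the invariant is the number of blocks.\<close>
      from inv(1)[OF this fin(2)] show "card (block_quotient A I M) = card (block_quotient B J N)"
        by (simp add: M N contraction_singletons card_image)
    qed
    then obtain \<sigma> where \<sigma>: "bij_betw \<sigma> A B" "\<sigma> ` M = N"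
      using bij_betw_extending_subsets[OF fin(1,3) sub cardB[symmetric]] by blast
    have "(\<lambda>S. \<sigma> ` S) ` F = G"
      unfolding M N \<sigma>(2)[symmetric] by (simp add: image_image)
    then show ?thesis
      using \<sigma>(1) by (auto simp: isomorphic_def)
  next
    assume "card F = 1"
    then obtain K where K: "F = {K}"
      by (auto simp: card_1_singleton_iff)
    have "card G = 1"
    proof (rule single_block_if_contractions[OF spG])
      fix J assume J: "J \<subseteq> B" "card J = 2"
      from GF[OF this] obtain I where
        "isomorphic (B // theta B J) (contraction B G J) (A // theta A I) (contraction A F I)"
        by blast
      from inv(1)[OF this fin(4)] show "card (contraction B G J) = 1"
        by (simp add: K contraction_single_block)
    qed (simp add: cardB assms(2))
    then obtain L where L: "G = {L}"
      by (auto simp: card_1_singleton_iff)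
    have sub: "K \<subseteq> A" "L \<subseteq> B"
      using fin K L by auto
    have "card K = card L"
    proof (intro card_eq sub)
      fix I J
      assume "isomorphic (A // theta A I) (contraction A F I) (B // theta B J) (contraction B G J)"
      \<comment> \<open>For a single block the invariant is the size of that block, expressed by
        \<open>homogeneous k\<close> for arbitrary k.\<close>
      from inv(2)[OF this fin(2)] show "card (block_quotient A I K) = card (block_quotient B J L)"
        by (simp add: K L contraction_single_block homogeneous_single)
    qed
    then obtain \<sigma> where \<sigma>: "bij_betw \<sigma> A B" "\<sigma> ` K = L"
      using bij_betw_extending_subsets[OF fin(1,3) sub cardB[symmetric]] by blast
    then show ?thesis
      using K L by (auto simp: isomorphic_def)
  qed
qed

theorem theorem4p10:
  fixes n :: nat and F :: "nat set set"
  assumes "sperner_system {1..n} F"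
    and "n \<ge> 4"
    and "homogeneous 1 F \<or> card F = 1"
  shows "reconstructible TYPE('b) {1..n} F"
  using assms by (intro reconstructible_1_homogeneous_or_single) auto

end
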